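(* Let $G$ be a finite simple graph on the vertex set $[\ell]=\{1,\dots,\ell\}$. For every integer $k\ge 0$ and every prime power $q$, the number $\chi(\mathcal{A}_G^q,q^k)/(q-1)^\ell$ is an integer and $$\frac{\chi(\mathcal{A}_G^q,q^k)}{(q-1)^\ell}\equiv \chi(G,k)\pmod{q-1}.$$
   Context: $q$ is a prime power and $\mathbb{F}_q$ the field with $q$ elements. A central arrangement $\mathcal{A}$ is a finite collection of linear hyperplanes in a finite dimensional vector space $V$. Its intersection lattice is $L(\mathcal{A})=\{\bigcap_{H\in\mathcal{B}}H \mid \mathcal{B}\subseteq\mathcal{A}\}$ (the empty intersection being $V$), ordered by reverse inclusion, and its characteristic polynomial is $\chi(\mathcal{A},t)=\sum_{X\in L(\mathcal{A})}\mu(X)t^{\dim X}$, where $\mu(X)=\mu(V,X)$ is the Möbius function of $L(\mathcal{A})$. For a simple graph $G$ on $[\ell]$, the $q$-deformation of the graphical arrangement is the arrangement in $\mathbb{F}_q^\ell$ (with coordinates $x_1,\dots,x_\ell$) $$\mathcal{A}_G^q=\bigcup_{\{i_1,\dots,i_r\}}\Big\{\{a_{i_1}x_{i_1}+\dots+a_{i_r}x_{i_r}=0\}\ \Big|\ (a_{i_1},\dots,a_{i_r})\in\mathbb{F}_q^r\setminus\{0\}\Big\},$$ where $\{i_1,\dots,i_r\}$ runs over all nonempty cliques of $G$ (sets of pairwise adjacent vertices, including single vertices). $\chi(G,t)$ denotes the chromatic polynomial of $G$. *)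

theory Defs
  imports
    "HOL-Computational_Algebra.Polynomial"
    "HOL-Number_Theory.Cong"
    "HOL-Library.FuncSet"
    "HOL-Library.Cardinality"
    "HOL-Library.Function_Algebras"
begin

section \<open>Characteristic polynomials of central arrangements\<close>

text \<open>
  The Moebius function \<open>\<mu>(X, Y)\<close> of a finite family \<open>L\<close> of sets ordered by \<^emph>\<open>reverse\<close> inclusion,
  so that \<open>X \<le> Y\<close> means \<open>Y \<subseteq> X\<close>. The finiteness guard only serves termination.
\<close>

function moebius :: "'b set set \<Rightarrow> 'b set \<Rightarrow> 'b set \<Rightarrow> int" where
  "moebius L X Y =
     (if X = Y then 1
      else if finite L \<and> Y \<subset> X then - (\<Sum>Z\<in>{Z \<in> L. Y \<subset> Z \<and> Z \<subseteq> X}. moebius L X Z)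
      else 0)"
  by pat_completeness auto
termination
proof (relation "measure (\<lambda>(L, X, Y). card {W \<in> L. Y \<subset> W})", goal_cases)
  case 1
  then show ?case by simp
next
  case (2 L X Y Z)
  then have "{W \<in> L. Z \<subset> W} \<subset> {W \<in> L. Y \<subset> W}" by auto
  with 2 show ?case by (auto intro!: psubset_card_mono)
qed

declare moebius.simps [simp del]

text \<open>
  An arrangement is a set \<open>A\<close> of hyperplanes of a subspace \<open>V\<close>, which plays the role of the ambient
  space. Intersecting with \<open>V\<close> makes the empty intersection equal to \<open>V\<close>.
\<close>

definition intersection_lattice :: "'b set \<Rightarrow> 'b set set \<Rightarrow> 'b set set" where
  "intersection_lattice V A = {V \<inter> \<Inter>B | B. B \<subseteq> A}"

definition (in vector_space) characteristic_poly :: "'b set \<Rightarrow> 'b set set \<Rightarrow> int poly" where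
  "characteristic_poly V A =
     (\<Sum>X\<in>intersection_lattice V A. monom (moebius (intersection_lattice V A) V X) (dim X))"

section \<open>Graphs\<close>

text \<open>A graph is given by its vertex set \<open>V\<close> and its set \<open>E\<close> of two-element edges.\<close>

definition simple_graph :: "'v set \<Rightarrow> 'v set set \<Rightarrow> bool" where
  "simple_graph V E \<longleftrightarrow> finite V \<and> (\<forall>e\<in>E. e \<subseteq> V \<and> card e = 2)"

definition clique :: "'v set \<Rightarrow> 'v set set \<Rightarrow> 'v set \<Rightarrow> bool" where
  "clique V E C \<longleftrightarrow> C \<subseteq> V \<and> (\<forall>u\<in>C. \<forall>v\<in>C. u \<noteq> v \<longrightarrow> {u, v} \<in> E)"

definition proper_colorings :: "'v set \<Rightarrow> 'v set set \<Rightarrow> nat \<Rightarrow> ('v \<Rightarrow> nat) set" where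
  "proper_colorings V E k = {f \<in> V \<rightarrow>\<^sub>E {1..k}. \<forall>u v. {u, v} \<in> E \<longrightarrow> f u \<noteq> f v}"

text \<open>The lemma \<open>poly_chromatic_poly\<close> below shows that this is well defined.\<close>

definition chromatic_poly :: "'v set \<Rightarrow> 'v set set \<Rightarrow> int poly" where
  "chromatic_poly V E =
     (THE p. \<forall>k::nat. poly p (int k) = int (card (proper_colorings V E k)))"

lemma card_monochromatic:
  fixes V :: "'v set"
  assumes "finite V" and S: "\<forall>e\<in>S. e \<subseteq> V"
  shows "\<exists>m. \<forall>k::nat. card {f \<in> V \<rightarrow>\<^sub>E {1..k}. \<forall>u v. {u, v} \<in> S \<longrightarrow> f u = f v} = k ^ m"
proof -
  define Q where "Q = {f::'v \<Rightarrow> nat. \<forall>u v. {u, v} \<in> S \<longrightarrow> f u = f v}"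
  define R where "R = {(u, v) \<in> V \<times> V. \<forall>f\<in>Q. f u = f v}"
  have "equiv V R"
    by (rule equivI) (auto simp: R_def intro!: refl_onI symI transI)
  have SR: "(a, b) \<in> R" if "{a, b} \<in> S" for a b
    using that S unfolding R_def Q_def by blast
  have "card {f \<in> V \<rightarrow>\<^sub>E {1..k}. \<forall>u v. {u, v} \<in> S \<longrightarrow> f u = f v} = k ^ card (V // R)" for k :: nat
  proof -
    let ?T = "{f \<in> V \<rightarrow>\<^sub>E {1..k}. \<forall>u v. {u, v} \<in> S \<longrightarrow> f u = f v}"
    let ?h = "\<lambda>g. \<lambda>x\<in>V. g (R `` {x})"
    have "bij_betw ?h ((V // R) \<rightarrow>\<^sub>E {1..k}) ?T"
    proof (rule bij_betw_imageI)
      show "inj_on ?h ((V // R) \<rightarrow>\<^sub>E {1..k})"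
      proof (rule inj_onI)
        fix g g' assume g: "g \<in> (V // R) \<rightarrow>\<^sub>E {1..k}" "g' \<in> (V // R) \<rightarrow>\<^sub>E {1..k}"
          and eq: "?h g = ?h g'"
        show "g = g'"
        proof (rule PiE_ext[OF g])
          fix c assume "c \<in> V // R"
          then obtain x where "x \<in> V" "c = R `` {x}" by (auto elim: quotientE)
          then show "g c = g' c" using fun_cong[OF eq, of x] by simp
        qed
      qed
      show "?h ` ((V // R) \<rightarrow>\<^sub>E {1..k}) = ?T"
      proof (intro equalityI subsetI)
        fix f assume "f \<in> ?h ` ((V // R) \<rightarrow>\<^sub>E {1..k})"
        then obtain g where g: "g \<in> (V // R) \<rightarrow>\<^sub>E {1..k}" "f = ?h g" by auto
        have "f \<in> V \<rightarrow>\<^sub>E {1..k}"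
          unfolding g(2) using g(1) by (intro restrict_PiE_iff[THEN iffD2]) (auto intro!: quotientI dest!: PiE_mem)
        moreover have "f u = f v" if "{u, v} \<in> S" for u v
        proof -
          have "R `` {u} = R `` {v}" by (rule equiv_class_eq[OF \<open>equiv V R\<close> SR[OF that]])
          moreover have "u \<in> V" "v \<in> V" using that S by auto
          ultimately show ?thesis by (simp add: g(2))
        qed
        ultimately show "f \<in> ?T" by auto
      next
        fix f assume f: "f \<in> ?T"
        have const: "f u = f v" if "(u, v) \<in> R" for u v
          using that f unfolding R_def Q_def by blast
        define g where "g = (\<lambda>c\<in>V // R. f (SOME x. x \<in> c))"
        have some: "(x, SOME y. y \<in> R `` {x}) \<in> R" if "x \<in> V" for x
          using someI[of "\<lambda>y. y \<in> R `` {x}" x] equiv_class_self[OF \<open>equiv V R\<close> that] by auto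
        have gx: "g (R `` {x}) = f x" if "x \<in> V" for x
          using const[OF some[OF that]] that by (simp add: g_def quotientI)
        have "?h g = f"
        proof
          fix x show "?h g x = f x"
            using f gx[of x] PiE_arb[of f V "\<lambda>_. {1..k}" x] by (cases "x \<in> V") simp_all
        qed
        moreover have "g \<in> (V // R) \<rightarrow>\<^sub>E {1..k}"
        proof (rule PiE_I)
          fix c assume "c \<in> V // R"
          then obtain x where "x \<in> V" "c = R `` {x}" by (auto elim: quotientE)
          moreover have "f x \<in> {1..k}" using f \<open>x \<in> V\<close> by (intro PiE_mem[of f V]) auto
          ultimately show "g c \<in> {1..k}" using gx by simp
        qed (simp add: g_def)
        ultimately show "f \<in> ?h ` ((V // R) \<rightarrow>\<^sub>E {1..k})" by (intro image_eqI[of _ _ g]) (rule sym)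
      qed
    qed
    then have "card ?T = card ((V // R) \<rightarrow>\<^sub>E {1..k})" by (simp add: bij_betw_same_card)
    also have "\<dots> = k ^ card (V // R)"
      using \<open>finite V\<close> \<open>equiv V R\<close> by (subst card_PiE) (auto intro: finite_quotient simp: equiv_def)
    finally show ?thesis .
  qed
  then show ?thesis by blast
qed

lemma ex_chromatic_poly:
  assumes "simple_graph V E"
  shows "\<exists>p. \<forall>k::nat. poly p (int k) = int (card (proper_colorings V E k))"
proof -
  have V: "finite V" and E: "\<forall>e\<in>E. e \<subseteq> V" and E2: "\<And>e. e \<in> E \<Longrightarrow> card e = 2"
    using assms by (auto simp: simple_graph_def)
  have "finite E" using V E by (meson PowI finite_Pow_iff finite_subset subsetI)
  have "\<exists>m. \<forall>S\<in>Pow E. \<forall>k::nat.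
      card {f \<in> V \<rightarrow>\<^sub>E {1..k}. \<forall>u v. {u, v} \<in> S \<longrightarrow> f u = f v} = k ^ m S"
    using card_monochromatic[OF V] E by (intro bchoice) blast
  then obtain m where m: "\<And>S k. S \<subseteq> E \<Longrightarrow>
      card {f \<in> V \<rightarrow>\<^sub>E {1..k::nat}. \<forall>u v. {u, v} \<in> S \<longrightarrow> f u = f v} = k ^ m S" by auto
  define mono where "mono = (\<lambda>(f::'a \<Rightarrow> nat) e. \<forall>u v. e = {u, v} \<longrightarrow> f u = f v)"
  define p where "p = (\<Sum>S\<in>Pow E. monom ((-1) ^ card S) (m S) :: int poly)"
  have "poly p (int k) = int (card (proper_colorings V E k))" for k
  proof -
    let ?F = "V \<rightarrow>\<^sub>E {1..k}"
    have finF: "finite ?F" using V by (intro finite_PiE) auto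
    have ind: "(\<Prod>e\<in>S. of_bool (mono f e)) = (of_bool (\<forall>u v. {u, v} \<in> S \<longrightarrow> f u = f v) :: int)"
      if "S \<subseteq> E" for S f
    proof (cases "\<forall>e\<in>S. mono f e")
      case True
      then show ?thesis by (auto simp: mono_def)
    next
      case False
      then obtain e where "e \<in> S" "\<not> mono f e" by auto
      moreover have "finite S" using that \<open>finite E\<close> finite_subset by blast
      ultimately have "(\<Prod>e\<in>S. of_bool (mono f e)) = (0::int)" by (intro prod_zero) auto
      moreover have "\<not> (\<forall>u v. {u, v} \<in> S \<longrightarrow> f u = f v)"
        using \<open>e \<in> S\<close> \<open>\<not> mono f e\<close> by (auto simp: mono_def)
      ultimately show ?thesis by auto
    qed
    have proper: "(\<Prod>e\<in>E. 1 - of_bool (mono f e)) =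
        (of_bool (\<forall>u v. {u, v} \<in> E \<longrightarrow> f u \<noteq> f v) :: int)" for f
    proof (cases "\<exists>e\<in>E. mono f e")
      case True
      then obtain e where e: "e \<in> E" "mono f e" by auto
      then have "(\<Prod>e\<in>E. 1 - of_bool (mono f e)) = (0::int)"
        using \<open>finite E\<close> by (intro prod_zero) auto
      moreover obtain u v where "e = {u, v}" using E2[OF e(1)] by (auto simp: card_2_iff)
      ultimately show ?thesis using e by (auto simp: mono_def)
    next
      case False
      have "f u \<noteq> f v" if "{u, v} \<in> E" for u v
      proof -
        have "\<not> mono f {u, v}" using False that by blast
        then show ?thesis by (auto simp: mono_def doubleton_eq_iff)
      qed
      moreover have "(\<Prod>e\<in>E. 1 - of_bool (mono f e)) = (1::int)"
        using False by (intro prod.neutral) auto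
      ultimately show ?thesis by auto
    qed
    have "int (card (proper_colorings V E k)) =
        (\<Sum>f\<in>?F. of_bool (\<forall>u v. {u, v} \<in> E \<longrightarrow> f u \<noteq> f v))"
      using finF by (simp add: proper_colorings_def of_bool_def sum.If_cases Int_def)
    also have "\<dots> = (\<Sum>f\<in>?F. \<Sum>S\<in>Pow E. (-1) ^ card S * (\<Prod>e\<in>S. of_bool (mono f e)))"
      by (simp add: proper[symmetric] prod_diff_conv_sum \<open>finite E\<close>)
    also have "\<dots> = (\<Sum>S\<in>Pow E. \<Sum>f\<in>?F. (-1) ^ card S * (\<Prod>e\<in>S. of_bool (mono f e)))"
      by (rule sum.swap)
    also have "\<dots> = (\<Sum>S\<in>Pow E. (-1) ^ card S * int k ^ m S)"
    proof (rule sum.cong[OF refl])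
      fix S assume "S \<in> Pow E"
      then have S: "S \<subseteq> E" by simp
      have "(\<Sum>f\<in>?F. (-1) ^ card S * (\<Prod>e\<in>S. of_bool (mono f e))) =
          (-1 :: int) ^ card S * (\<Sum>f\<in>?F. of_bool (\<forall>u v. {u, v} \<in> S \<longrightarrow> f u = f v))"
        by (simp only: sum_distrib_left ind[OF S])
      also have "(\<Sum>f\<in>?F. of_bool (\<forall>u v. {u, v} \<in> S \<longrightarrow> f u = f v)) =
          int (card {f \<in> ?F. \<forall>u v. {u, v} \<in> S \<longrightarrow> f u = f v})"
        using finF by (simp add: of_bool_def sum.If_cases Int_def)
      finally show "(\<Sum>f\<in>?F. (-1) ^ card S * (\<Prod>e\<in>S. of_bool (mono f e))) =
          (-1) ^ card S * int k ^ m S"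
        by (simp only: m[OF S] of_nat_power)
    qed
    also have "\<dots> = poly p (int k)"
      by (simp add: p_def poly_sum poly_monom)
    finally show ?thesis by simp
  qed
  then show ?thesis by blast
qed

lemma poly_chromatic_poly:
  assumes "simple_graph V E"
  shows "poly (chromatic_poly V E) (int k) = int (card (proper_colorings V E k))"
proof -
  have "\<exists>!p. \<forall>k::nat. poly p (int k) = int (card (proper_colorings V E k))"
  proof (rule ex_ex1I[OF ex_chromatic_poly[OF assms]])
    fix p r :: "int poly"
    assume "\<forall>k::nat. poly p (int k) = int (card (proper_colorings V E k))"
      and "\<forall>k::nat. poly r (int k) = int (card (proper_colorings V E k))"
    then have "range int \<subseteq> {x. poly (p - r) x = 0}" by auto
    moreover have "infinite (range int)" by (simp add: finite_image_iff)
    ultimately have "infinite {x. poly (p - r) x = 0}" using finite_subset by blast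
    then have "p - r = 0" using poly_roots_finite by blast
    then show "p = r" by simp
  qed
  from theI'[OF this] show ?thesis unfolding chromatic_poly_def by blast
qed

section \<open>The \<open>q\<close>-deformation of a graphical arrangement\<close>

global_interpretation coord: vector_space "\<lambda>(c::'a::field) (x::nat \<Rightarrow> 'a) i. c * x i"
  by unfold_locales (auto simp: fun_eq_iff algebra_simps)

text \<open>The space of vectors with coordinates \<open>x\<^sub>1, \<dots>, x\<^sub>l\<close>; the other entries are zero.\<close>

definition coord_space :: "nat \<Rightarrow> (nat \<Rightarrow> 'a::field) set" where
  "coord_space l = {x. \<forall>i. i \<notin> {1..l} \<longrightarrow> x i = 0}"

text \<open>
  The field is the element type \<open>'a\<close>: for a finite field with \<open>q\<close> elements this is the
  \<open>q\<close>-deformation.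
\<close>

definition deformed_arrangement :: "nat \<Rightarrow> nat set set \<Rightarrow> (nat \<Rightarrow> 'a::field) set set" where
  "deformed_arrangement l E =
     {{x \<in> coord_space l. (\<Sum>i\<in>C. a i * x i) = 0} | C a.
        clique {1..l} E C \<and> C \<noteq> {} \<and> (\<exists>i\<in>C. a i \<noteq> 0)}"

end

theory Submission
  imports Defs
begin

text \<open>
  Write \<open>F\<close> for the field with \<open>q\<close> elements. Moebius inversion over the intersection lattice shows that
  \<open>\<chi>(A, q\<^sup>k)\<close> counts the \<open>k\<close>-tuples of vectors of \<open>F\<^sup>l\<close> that do not lie in a common hyperplane of
  \<open>A\<close>. Such a tuple is a matrix with \<open>k\<close> columns in \<open>F\<^sup>l\<close>; read by its \<open>l\<close> rows, which belong to
  \<open>F\<^sup>k\<close>, the condition for the deformed arrangement of \<open>G\<close> says that the rows indexed by a clique of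
  \<open>G\<close> are linearly independent (\<open>poly_characteristic_poly_deformed_arrangement\<close>).

  Independence survives rescaling of rows and of columns, so the torus of such rescalings acts on
  these matrices. If every row has just one nonzero entry, then the positions of these entries
  form a map from the vertices to the \<open>k\<close> columns, and the rows of a clique are independent exactly
  when this map is injective on the clique, so when it is a proper coloring. The values of the
  entries are free, which gives \<open>(q - 1)\<^sup>l \<chi>(G, k)\<close> matrices (\<open>card_monomial\<close>). On the remaining
  matrices one can choose a column that meets a row with another nonzero entry; scaling the
  \<open>l\<close> rows and this column is a free action of a group of order \<open>(q - 1)\<^bsup>l+1\<^esup>\<close>, so their number is
  a multiple of this order (\<open>card_nonmonomial_dvd\<close>) and vanishes modulo \<open>q - 1\<close> after division by
  \<open>(q - 1)\<^sup>l\<close>.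
\<close>

section \<open>The critical theorem of Crapo and Rota\<close>

lemma (in vector_space) card_finite_subspace:
  assumes "finite (UNIV :: 'a set)" "finite X" "subspace X"
  shows "card X = CARD('a) ^ dim X"
proof -
  obtain B where B: "B \<subseteq> X" "independent B" "X \<subseteq> span B" "card B = dim X"
    using basis_exists by blast
  have [simp]: "finite B" using B(1) assms(2) finite_subset by blast
  have X: "X = span B"
    using B(1,3) span_minimal[OF B(1) assms(3)] by blast
  let ?h = "\<lambda>u. \<Sum>b\<in>B. scale (u b) b"
  have "bij_betw ?h (B \<rightarrow>\<^sub>E UNIV) X"
  proof (rule bij_betw_imageI)
    show "inj_on ?h (B \<rightarrow>\<^sub>E UNIV)"
    proof (rule inj_onI)
      fix u w assume u: "u \<in> B \<rightarrow>\<^sub>E UNIV" "w \<in> B \<rightarrow>\<^sub>E UNIV" and eq: "?h u = ?h w"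
      have "(\<Sum>b\<in>B. scale (u b - w b) b) = 0"
        using eq by (simp add: scale_left_diff_distrib sum_subtractf)
      then have "u b - w b = 0" if "b \<in> B" for b
        using independentD[OF B(2) \<open>finite B\<close> order_refl, of "\<lambda>b. u b - w b"] that by blast
      then show "u = w" by (intro PiE_ext[OF u]) auto
    qed
    show "?h ` (B \<rightarrow>\<^sub>E UNIV) = X"
    proof (intro equalityI subsetI)
      fix x assume "x \<in> X"
      then obtain u where "x = ?h u"
        unfolding X span_finite[OF \<open>finite B\<close>] by auto
      then have "x = ?h (restrict u B)" by simp
      then show "x \<in> ?h ` (B \<rightarrow>\<^sub>E UNIV)" by (intro image_eqI[of _ _ "restrict u B"]) auto
    qed (auto simp: X span_finite)
  qed
  then have "card X = card (B \<rightarrow>\<^sub>E (UNIV :: 'a set))"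
    by (simp add: bij_betw_same_card)
  also have "\<dots> = CARD('a) ^ dim X"
    by (simp add: card_PiE B(4))
  finally show ?thesis .
qed

text \<open>The recursion says that \<open>moebius\<close> inverts summation over the intervals starting at \<open>V\<close>.\<close>

lemma sum_moebius:
  assumes "finite L" "\<And>Z. Z \<in> L \<Longrightarrow> Z \<subseteq> V" "V \<in> L" "Y \<in> L"
  shows "(\<Sum>Z\<in>{Z \<in> L. Y \<subseteq> Z}. moebius L V Z) = of_bool (Y = V)"
proof (cases "Y = V")
  case True
  then have "{Z \<in> L. Y \<subseteq> Z} = {V}" using assms by auto
  then show ?thesis using True by (simp add: moebius.simps[of L V V])
next
  case False
  then have "Y \<subset> V" using assms by auto
  have "{Z \<in> L. Y \<subseteq> Z} = insert Y {Z \<in> L. Y \<subset> Z \<and> Z \<subseteq> V}" using assms by auto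
  then show ?thesis
    using \<open>Y \<subset> V\<close> assms(1) by (simp add: moebius.simps[of L V Y])
qed

text \<open>
  A flat of dimension \<open>d\<close> contains \<open>q\<^bsup>k d\<^esup>\<close> of the \<open>k\<close>-tuples of vectors, so \<open>\<chi>(A, q\<^sup>k)\<close> is a sum of
  Moebius values over pairs of a flat and a tuple inside it. For a fixed tuple these values are
  summed over an interval of the lattice, from \<open>V\<close> to the smallest flat through the tuple; the
  sum is zero unless this flat is \<open>V\<close> itself.
\<close>

theorem (in vector_space) poly_characteristic_poly:
  assumes "finite (UNIV :: 'a set)" "finite V" "subspace V"
    and A: "\<And>H. H \<in> A \<Longrightarrow> subspace H \<and> H \<subset> V"
  shows "poly (characteristic_poly V A) (int (CARD('a) ^ k)) =
    int (card {t \<in> {1..k} \<rightarrow>\<^sub>E V. \<forall>H\<in>A. \<exists>j\<in>{1..k}. t j \<notin> H})"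
proof -
  define L where "L = intersection_lattice V A"
  define T where "T = {1..k} \<rightarrow>\<^sub>E V"
  have LV: "Z \<subseteq> V" if "Z \<in> L" for Z
    using that by (auto simp: L_def intersection_lattice_def)
  have "finite L"
    using LV by (intro finite_subset[of L "Pow V"]) (auto simp: assms)
  have sub: "subspace Z" if "Z \<in> L" for Z
    using that A \<open>subspace V\<close> unfolding L_def intersection_lattice_def
    by (auto intro!: subspace_inter subspace_Inter)
  have finZ: "finite Z" if "Z \<in> L" for Z
    using LV[OF that] \<open>finite V\<close> finite_subset by blast
  have "V \<in> L"
    unfolding L_def intersection_lattice_def by (intro CollectI exI[of _ "{}"]) auto
  have "finite T" unfolding T_def by (intro finite_PiE) (auto simp: assms)
  have inner: "(\<Sum>Z\<in>{Z \<in> L. t ` {1..k} \<subseteq> Z}. moebius L V Z) =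
      of_bool (\<forall>H\<in>A. \<exists>j\<in>{1..k}. t j \<notin> H)" if "t \<in> T" for t
  proof -
    \<comment> \<open>the smallest flat through the entries of \<open>t\<close>\<close>
    define Y where "Y = V \<inter> \<Inter>{H \<in> A. t ` {1..k} \<subseteq> H}"
    have "Y \<in> L" unfolding Y_def L_def intersection_lattice_def by blast
    have tV: "t ` {1..k} \<subseteq> V" using that by (auto simp: T_def)
    have "t ` {1..k} \<subseteq> Z \<longleftrightarrow> Y \<subseteq> Z" if Z: "Z \<in> L" for Z
    proof
      assume t: "t ` {1..k} \<subseteq> Z"
      obtain B where B: "B \<subseteq> A" "Z = V \<inter> \<Inter>B"
        using Z by (auto simp: L_def intersection_lattice_def)
      have "B \<subseteq> {H \<in> A. t ` {1..k} \<subseteq> H}" using t B by blast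
      then show "Y \<subseteq> Z" unfolding B(2) Y_def by blast
    next
      assume "Y \<subseteq> Z"
      then show "t ` {1..k} \<subseteq> Z" using tV unfolding Y_def by blast
    qed
    then have "{Z \<in> L. t ` {1..k} \<subseteq> Z} = {Z \<in> L. Y \<subseteq> Z}" by blast
    moreover have "Y = V \<longleftrightarrow> (\<forall>H\<in>A. \<exists>j\<in>{1..k}. t j \<notin> H)"
    proof
      assume "Y = V"
      show "\<forall>H\<in>A. \<exists>j\<in>{1..k}. t j \<notin> H"
      proof (rule ccontr)
        assume "\<not> ?thesis"
        then obtain H where H: "H \<in> A" "t ` {1..k} \<subseteq> H" by blast
        then have "V \<subseteq> H" using \<open>Y = V\<close> unfolding Y_def by blast
        then show False using A[OF H(1)] by blast
      qed
    next
      assume "\<forall>H\<in>A. \<exists>j\<in>{1..k}. t j \<notin> H"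
      then have "{H \<in> A. t ` {1..k} \<subseteq> H} = {}" by blast
      then show "Y = V" unfolding Y_def by (simp only: Inter_empty Int_UNIV_right)
    qed
    ultimately show ?thesis
      using sum_moebius[OF \<open>finite L\<close> LV \<open>V \<in> L\<close> \<open>Y \<in> L\<close>] by simp
  qed
  have "poly (characteristic_poly V A) (int (CARD('a) ^ k)) =
      (\<Sum>Z\<in>L. moebius L V Z * int (card Z ^ k))"
    unfolding characteristic_poly_def L_def[symmetric] poly_sum poly_monom
    by (intro sum.cong refl)
      (simp add: card_finite_subspace[OF assms(1) finZ sub] mult.commute flip: power_mult)
  also have "\<dots> = (\<Sum>Z\<in>L. \<Sum>t\<in>{t \<in> T. t ` {1..k} \<subseteq> Z}. moebius L V Z)"
  proof (rule sum.cong[OF refl])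
    fix Z assume "Z \<in> L"
    have "t \<in> T \<and> t ` {1..k} \<subseteq> Z \<longleftrightarrow> t \<in> {1..k} \<rightarrow>\<^sub>E Z" for t
      using LV[OF \<open>Z \<in> L\<close>] unfolding T_def PiE_iff image_subset_iff by blast
    then have "{t \<in> T. t ` {1..k} \<subseteq> Z} = {1..k} \<rightarrow>\<^sub>E Z" by blast
    then show "moebius L V Z * int (card Z ^ k) = (\<Sum>t\<in>{t \<in> T. t ` {1..k} \<subseteq> Z}. moebius L V Z)"
      by (simp add: card_PiE)
  qed
  also have "\<dots> = (\<Sum>t\<in>T. \<Sum>Z\<in>{Z \<in> L. t ` {1..k} \<subseteq> Z}. moebius L V Z)"
    by (rule sum.swap_restrict[OF \<open>finite L\<close> \<open>finite T\<close>])
  also have "\<dots> = (\<Sum>t\<in>T. of_bool (\<forall>H\<in>A. \<exists>j\<in>{1..k}. t j \<notin> H))"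
    by (intro sum.cong refl inner)
  also have "\<dots> = int (card {t \<in> T. \<forall>H\<in>A. \<exists>j\<in>{1..k}. t j \<notin> H})"
    using \<open>finite T\<close> by (simp add: of_bool_def sum.If_cases Int_def)
  finally show ?thesis unfolding T_def .
qed

section \<open>Matrices whose rows are independent on cliques\<close>

text \<open>
  A matrix \<open>y\<close> is stored by columns: \<open>y j i\<close> is the entry in row \<open>i\<close> and column \<open>j\<close>, so that
  \<open>y j\<close> is a point of the ambient space of the arrangement.
\<close>

definition clique_independent :: "nat \<Rightarrow> nat set set \<Rightarrow> nat \<Rightarrow> (nat \<Rightarrow> nat \<Rightarrow> 'a::field) set" where
  "clique_independent l E k =
     {y \<in> {1..k} \<rightarrow>\<^sub>E coord_space l.
        \<forall>C a. clique {1..l} E C \<longrightarrow> (\<exists>i\<in>C. a i \<noteq> 0) \<longrightarrow> (\<exists>j\<in>{1..k}. (\<Sum>i\<in>C. a i * y j i) \<noteq> 0)}"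

lemma clique_finite: "clique {1..l} E C \<Longrightarrow> finite (C :: nat set)"
  by (auto simp: clique_def intro: finite_subset)

lemma subspace_coord_space: "coord.subspace (coord_space l :: (nat \<Rightarrow> 'a::field) set)"
  by (auto simp: coord.subspace_def coord_space_def)

lemma finite_coord_space: "finite (coord_space l :: (nat \<Rightarrow> 'a::{field, finite}) set)"
proof -
  have "coord_space l \<subseteq> (\<lambda>u i. if i \<in> {1..l} then u i else (0::'a)) ` ({1..l} \<rightarrow>\<^sub>E UNIV)"
  proof
    fix x :: "nat \<Rightarrow> 'a" assume "x \<in> coord_space l"
    then have "x = (\<lambda>i. if i \<in> {1..l} then restrict x {1..l} i else 0)"
      by (auto simp: coord_space_def)
    then show "x \<in> (\<lambda>u i. if i \<in> {1..l} then u i else 0) ` ({1..l} \<rightarrow>\<^sub>E UNIV)"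
      by (intro image_eqI[of _ _ "restrict x {1..l}"]) auto
  qed
  then show ?thesis by (rule finite_subset) (auto intro!: finite_imageI finite_PiE)
qed

lemma deformed_arrangement_hyperplane:
  assumes "H \<in> deformed_arrangement l E"
  shows "coord.subspace H \<and> H \<subset> coord_space l"
proof -
  obtain C and a :: "nat \<Rightarrow> 'a"
    where H: "H = {x \<in> coord_space l. (\<Sum>i\<in>C. a i * x i) = 0}" and C: "clique {1..l} E C"
      and "\<exists>i\<in>C. a i \<noteq> 0"
    using assms by (auto simp: deformed_arrangement_def)
  then obtain m where m: "m \<in> C" "a m \<noteq> 0" by auto
  have "coord.subspace H"
    unfolding coord.subspace_def H coord_space_def
    by (auto simp: distrib_left sum.distrib mult.left_commute simp flip: sum_distrib_left)
  define x where "x = (\<lambda>i. of_bool (i = m) :: 'a)"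
  have "x \<in> coord_space l" using C m by (auto simp: x_def coord_space_def clique_def)
  moreover have "(\<Sum>i\<in>C. a i * x i) = a m"
    using m clique_finite[OF C] by (simp add: x_def of_bool_def if_distrib cong: if_cong)
  ultimately have "x \<in> coord_space l - H" using m by (simp add: H)
  then show ?thesis using \<open>coord.subspace H\<close> H by blast
qed

lemma poly_characteristic_poly_deformed_arrangement:
  "poly (coord.characteristic_poly (coord_space l :: (nat \<Rightarrow> 'a) set) (deformed_arrangement l E))
      (int (CARD('a) ^ k)) =
    int (card (clique_independent l E k :: (nat \<Rightarrow> nat \<Rightarrow> 'a::{field, finite}) set))"
proof -
  have "{t \<in> {1..k} \<rightarrow>\<^sub>E coord_space l. \<forall>H\<in>deformed_arrangement l E. \<exists>j\<in>{1..k}. t j \<notin> H} =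
      (clique_independent l E k :: (nat \<Rightarrow> nat \<Rightarrow> 'a) set)"
    (is "?S = _")
  proof (intro set_eqI)
    fix y :: "nat \<Rightarrow> nat \<Rightarrow> 'a"
    have "(\<exists>j\<in>{1..k}. y j \<notin> {x \<in> coord_space l. (\<Sum>i\<in>C. a i * x i) = 0}) \<longleftrightarrow>
        (\<exists>j\<in>{1..k}. (\<Sum>i\<in>C. a i * y j i) \<noteq> 0)" if "y \<in> {1..k} \<rightarrow>\<^sub>E coord_space l" for C a
      using that by (auto simp: PiE_iff)
    then show "y \<in> ?S \<longleftrightarrow> y \<in> clique_independent l E k"
      unfolding clique_independent_def deformed_arrangement_def by blast
  qed
  moreover have "poly (coord.characteristic_poly (coord_space l :: (nat \<Rightarrow> 'a) set) (deformed_arrangement l E))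
      (int (CARD('a) ^ k)) = int (card ?S)"
    by (rule coord.poly_characteristic_poly)
      (rule finite finite_coord_space subspace_coord_space deformed_arrangement_hyperplane)+
  ultimately show ?thesis by (simp only:)
qed

lemma finite_clique_independent:
  "finite (clique_independent l E k :: (nat \<Rightarrow> nat \<Rightarrow> 'a::{field, finite}) set)"
  unfolding clique_independent_def
  by (rule finite_subset[of _ "{1..k} \<rightarrow>\<^sub>E coord_space l"])
    (auto intro!: finite_PiE finite_coord_space)

text \<open>A single vertex is a clique.\<close>

lemma clique_independent_row_nonzero:
  assumes "y \<in> clique_independent l E k" "i \<in> {1..l}"
  obtains j where "j \<in> {1..k}" "y j i \<noteq> 0"
proof -
  have "clique {1..l} E {i}" using assms by (auto simp: clique_def)
  then have "\<exists>j\<in>{1..k}. (\<Sum>m\<in>{i}. 1 * y j m) \<noteq> 0"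
    using assms(1) unfolding clique_independent_def
    by (elim CollectE conjE allE[of _ "{i}"] allE[of _ "\<lambda>_. 1"]) auto
  then show ?thesis using that by auto
qed

text \<open>
  A row factor \<open>c i\<close> can be moved into the coefficients of a linear relation between the rows, and a
  column factor \<open>d j\<close> only rescales the value of the relation in column \<open>j\<close>.
\<close>

lemma clique_independent_scale:
  assumes y: "y \<in> clique_independent l E k"
    and "\<And>i. i \<in> {1..l} \<Longrightarrow> c i \<noteq> 0" "\<And>j. j \<in> {1..k} \<Longrightarrow> d j \<noteq> 0"
  shows "(\<lambda>j\<in>{1..k}. \<lambda>i. d j * c i * y j i) \<in> clique_independent l E k"
proof -
  have "y j \<in> coord_space l" if "j \<in> {1..k}" for j
    using y that by (auto simp: clique_independent_def)
  moreover have "\<exists>j\<in>{1..k}. (\<Sum>i\<in>C. a i * (d j * c i * y j i)) \<noteq> 0"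
    if C: "clique {1..l} E C" "\<exists>i\<in>C. a i \<noteq> 0" for C a
  proof -
    have "c i \<noteq> 0" if "i \<in> C" for i
      using C(1) assms(2) that unfolding clique_def by blast
    then have "\<exists>i\<in>C. a i * c i \<noteq> 0" using C(2) by auto
    then obtain j where j: "j \<in> {1..k}" "(\<Sum>i\<in>C. (a i * c i) * y j i) \<noteq> 0"
      using y C(1) unfolding clique_independent_def
      by (elim CollectE conjE allE[of _ C] allE[of _ "\<lambda>i. a i * c i"]) auto
    have "(\<Sum>i\<in>C. a i * (d j * c i * y j i)) = d j * (\<Sum>i\<in>C. (a i * c i) * y j i)"
      by (simp add: sum_distrib_left mult_ac)
    then show ?thesis using j(2) assms(3)[OF j(1)] by (intro bexI[OF _ j(1)]) simp
  qed
  ultimately show ?thesis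
    unfolding clique_independent_def by (auto simp: coord_space_def)
qed

section \<open>Counting the matrices modulo the torus\<close>

definition monomial_rows :: "nat \<Rightarrow> (nat \<Rightarrow> nat \<Rightarrow> 'a::zero) \<Rightarrow> bool" where
  "monomial_rows k y \<longleftrightarrow>
     (\<forall>i. \<forall>j\<in>{1..k}. \<forall>j'\<in>{1..k}. y j i \<noteq> 0 \<longrightarrow> y j' i \<noteq> 0 \<longrightarrow> j = j')"

text \<open>
  All orbits of a free action have the size of the group. The group structure enters only through
  its effect on \<open>B\<close>: the existence of a neutral element, inverses and products makes
  \<open>B\<close> the disjoint union of its orbits.
\<close>

lemma card_dvd_of_free_action:
  assumes "finite B"
    and closed: "\<And>g y. g \<in> K \<Longrightarrow> y \<in> B \<Longrightarrow> act g y \<in> B"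
    and one: "\<And>y. y \<in> B \<Longrightarrow> \<exists>g\<in>K. act g y = y"
    and inverse: "\<And>g y. g \<in> K \<Longrightarrow> y \<in> B \<Longrightarrow> \<exists>h\<in>K. act h (act g y) = y"
    and mult: "\<And>g h y. g \<in> K \<Longrightarrow> h \<in> K \<Longrightarrow> y \<in> B \<Longrightarrow> \<exists>m\<in>K. act h (act g y) = act m y"
    and free: "\<And>y. y \<in> B \<Longrightarrow> inj_on (\<lambda>g. act g y) K"
  shows "card K dvd card B"
proof -
  define r where "r = {(y, z). y \<in> B \<and> (\<exists>g\<in>K. z = act g y)}"
  have "equiv B r"
  proof (rule equivI)
    show "r \<subseteq> B \<times> B" using closed by (auto simp: r_def)
    show "refl_on B r" unfolding refl_on_def r_def using one by (auto, metis)
    show "sym r"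
    proof (rule symI)
      fix y z assume "(y, z) \<in> r"
      then obtain g where g: "y \<in> B" "g \<in> K" "z = act g y" by (auto simp: r_def)
      then obtain h where "h \<in> K" "act h z = y" using inverse by blast
      then show "(z, y) \<in> r" using g closed by (auto simp: r_def intro!: bexI[of _ h])
    qed
    show "trans r"
    proof (rule transI)
      fix x y z assume "(x, y) \<in> r" "(y, z) \<in> r"
      then obtain g h where "x \<in> B" "g \<in> K" "y = act g x" "h \<in> K" "z = act h y"
        by (auto simp: r_def)
      then show "(x, z) \<in> r" using mult by (fastforce simp: r_def)
    qed
  qed
  moreover have "card K dvd card X" if X: "X \<in> B // r" for X
  proof -
    obtain y where y: "y \<in> B" "X = r `` {y}" using X by (auto elim: quotientE)
    then have "X = (\<lambda>g. act g y) ` K" by (auto simp: r_def)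
    then show ?thesis using card_image[OF free[OF y(1)]] by simp
  qed
  ultimately show ?thesis
    using \<open>finite B\<close> by (intro equiv_imp_dvd_card[of B r]) auto
qed

text \<open>
  A group element is a pair of one column factor and \<open>l\<close> row factors. The column \<open>col y\<close> that is scaled
  depends on \<open>y\<close>, but only on the positions of its nonzero entries; these are preserved, so this
  is an action. It is free: in the row where \<open>y\<close> has nonzero entries both in \<open>col y\<close> and elsewhere, the
  entry elsewhere determines the row factor, and then the entry in \<open>col y\<close> determines the column factor.
  The factors of the other rows follow, because no row is zero.
\<close>

lemma card_nonmonomial_dvd:
  "(CARD('a) - 1) ^ Suc l dvd
     card {y \<in> clique_independent l E k :: (nat \<Rightarrow> nat \<Rightarrow> 'a::{field, finite}) set.
       \<not> monomial_rows k y}" (is "_ dvd card ?B")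
proof -
  define col :: "(nat \<Rightarrow> nat \<Rightarrow> 'a) \<Rightarrow> nat" where
    "col y = (SOME j. j \<in> {1..k} \<and> (\<exists>i. \<exists>j'\<in>{1..k}. j' \<noteq> j \<and> y j i \<noteq> 0 \<and> y j' i \<noteq> 0))" for y
  define D where "D y s j = (if j = col y then s else 1)" for y and s :: 'a and j
  define act where "act g y = (\<lambda>j\<in>{1..k}. \<lambda>i. D y (fst g) j * snd g i * y j i)"
    for g :: "'a \<times> (nat \<Rightarrow> 'a)" and y
  define K where "K = (UNIV - {0::'a}) \<times> ({1..l} \<rightarrow>\<^sub>E (UNIV - {0::'a}))"
  have zero: "y j i = 0" if "y \<in> ?B" "j \<in> {1..k}" "i \<notin> {1..l}" for y j i
    using that by (auto simp: clique_independent_def coord_space_def PiE_iff)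
  have Knz: "fst g \<noteq> 0" "\<And>i. i \<in> {1..l} \<Longrightarrow> snd g i \<noteq> 0" if "g \<in> K" for g
    using that by (auto simp: K_def PiE_iff)
  have supp: "act g y j i \<noteq> 0 \<longleftrightarrow> y j i \<noteq> 0" if "g \<in> K" "y \<in> ?B" "j \<in> {1..k}" for g y j i
    using Knz[OF \<open>g \<in> K\<close>] zero[OF that(2,3), of i] that(3)
    by (cases "i \<in> {1..l}") (auto simp: act_def D_def)
  have col_act: "col (act g y) = col y" if "g \<in> K" "y \<in> ?B" for g y
    unfolding col_def using supp[OF that] by (intro arg_cong[of _ _ Eps] ext) blast
  have col: "col y \<in> {1..k}" "\<exists>i. \<exists>j\<in>{1..k}. j \<noteq> col y \<and> y (col y) i \<noteq> 0 \<and> y j i \<noteq> 0"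
    if "y \<in> ?B" for y
  proof -
    have "\<exists>j. j \<in> {1..k} \<and> (\<exists>i. \<exists>j'\<in>{1..k}. j' \<noteq> j \<and> y j i \<noteq> 0 \<and> y j' i \<noteq> 0)"
      using that unfolding monomial_rows_def by blast
    from someI_ex[OF this]
    show "col y \<in> {1..k}" "\<exists>i. \<exists>j\<in>{1..k}. j \<noteq> col y \<and> y (col y) i \<noteq> 0 \<and> y j i \<noteq> 0"
      unfolding col_def by blast+
  qed
  have act_act: "act h (act g y) = act (fst h * fst g, \<lambda>i\<in>{1..l}. snd h i * snd g i) y"
    if "g \<in> K" "y \<in> ?B" for g h y
  proof (intro ext)
    fix j i
    show "act h (act g y) j i = act (fst h * fst g, \<lambda>i\<in>{1..l}. snd h i * snd g i) y j i"
      using zero[OF that(2), of j i] col_act[OF that]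
      by (cases "j \<in> {1..k}"; cases "i \<in> {1..l}") (auto simp: act_def D_def)
  qed
  have act_one: "act (1, \<lambda>i\<in>{1..l}. 1) y = y" if "y \<in> ?B" for y
  proof (intro ext)
    fix j i
    have "y j = undefined" if "j \<notin> {1..k}"
      using that \<open>y \<in> ?B\<close> by (auto simp: clique_independent_def PiE_iff extensional_def)
    then show "act (1, \<lambda>i\<in>{1..l}. 1) y j i = y j i"
      using zero[OF that, of j i]
      by (cases "j \<in> {1..k}"; cases "i \<in> {1..l}") (auto simp: act_def D_def)
  qed
  have "card K dvd card ?B"
  proof (rule card_dvd_of_free_action[where act = act])
    show "finite ?B" using finite_clique_independent by (rule finite_subset[rotated]) auto
    show "act g y \<in> ?B" if "g \<in> K" "y \<in> ?B" for g y
    proof -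
      have "act g y \<in> clique_independent l E k"
        unfolding act_def using that Knz[OF that(1)]
        by (intro clique_independent_scale) (auto simp: D_def)
      moreover have "\<not> monomial_rows k (act g y)"
        using that(2) supp[OF that] unfolding monomial_rows_def by blast
      ultimately show ?thesis by blast
    qed
    show "\<exists>g\<in>K. act g y = y" if "y \<in> ?B" for y
      using act_one[OF that] by (intro bexI[of _ "(1, \<lambda>i\<in>{1..l}. 1)"]) (auto simp: K_def)
    show "\<exists>h\<in>K. act h (act g y) = y" if "g \<in> K" "y \<in> ?B" for g y
    proof (rule bexI[of _ "(inverse (fst g), \<lambda>i\<in>{1..l}. inverse (snd g i))"])
      have "(\<lambda>i\<in>{1..l}. (\<lambda>i\<in>{1..l}. inverse (snd g i)) i * snd g i) = (\<lambda>i\<in>{1..l}. 1)"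
        using Knz(2)[OF that(1)] by (intro restrict_ext) auto
      then show "act (inverse (fst g), \<lambda>i\<in>{1..l}. inverse (snd g i)) (act g y) = y"
        unfolding act_act[OF that] using Knz(1)[OF that(1)] act_one[OF that(2)] by simp
    qed (use Knz[OF that(1)] in \<open>auto simp: K_def\<close>)
    show "\<exists>m\<in>K. act h (act g y) = act m y" if "g \<in> K" "h \<in> K" "y \<in> ?B" for g h y
      unfolding act_act[OF that(1,3)] using Knz[OF that(1)] Knz[OF that(2)]
      by (intro bexI[where x = "(fst h * fst g, \<lambda>i\<in>{1..l}. snd h i * snd g i)"]) (auto simp: K_def)
    show "inj_on (\<lambda>g. act g y) K" if y: "y \<in> ?B" for y
    proof (rule inj_onI)
      fix g h assume gh: "g \<in> K" "h \<in> K" and eq: "act g y = act h y"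
      have entry: "D y (fst g) j * snd g i = D y (fst h) j * snd h i"
        if "j \<in> {1..k}" "y j i \<noteq> 0" for i j
        using fun_cong[OF fun_cong[OF eq, of j], of i] that by (simp add: act_def)
      obtain i j where ij: "j \<in> {1..k}" "j \<noteq> col y" "y (col y) i \<noteq> 0" "y j i \<noteq> 0"
        using col(2)[OF y] by blast
      have i: "i \<in> {1..l}" using zero[OF y ij(1), of i] ij(4) by blast
      have "snd g i = snd h i" using entry[OF ij(1,4)] ij(2) by (simp add: D_def)
      then have fst: "fst g = fst h"
        using entry[OF col(1)[OF y] ij(3)] Knz(2)[OF gh(2) i] by (simp add: D_def)
      have "snd g m = snd h m" if m: "m \<in> {1..l}" for m
      proof -
        have "y \<in> clique_independent l E k" using y by simp
        then obtain j where "j \<in> {1..k}" "y j m \<noteq> 0"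
          using m by (rule clique_independent_row_nonzero)
        from entry[OF this] show ?thesis
          using fst Knz(1)[OF gh(2)] by (auto simp: D_def split: if_splits)
      qed
      then have "snd g = snd h"
        using gh by (intro PiE_ext[of _ "{1..l}" "\<lambda>_. UNIV - {0}"]) (auto simp: K_def)
      then show "g = h" using fst by (simp add: prod_eq_iff)
    qed
  qed
  moreover have "card K = (CARD('a) - 1) ^ Suc l"
    by (simp add: K_def card_cartesian_product card_PiE card_Diff_singleton)
  ultimately show ?thesis by simp
qed

text \<open>
  A monomial matrix is a pair \<open>(f, c)\<close>: row \<open>i\<close> has the entry \<open>c i\<close> in column \<open>f i\<close>. If \<open>f\<close> is injective
  on a clique, then a relation with a nonzero coefficient at \<open>m\<close> is not zero in column \<open>f m\<close>, since
  only row \<open>m\<close> contributes there; if \<open>f\<close> agrees on two adjacent vertices, then their rows are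
  proportional.
\<close>

lemma card_monomial:
  assumes "simple_graph {1..l} E"
  shows "card {y \<in> clique_independent l E k :: (nat \<Rightarrow> nat \<Rightarrow> 'a::{field, finite}) set.
           monomial_rows k y} =
         (CARD('a) - 1) ^ l * card (proper_colorings {1..l} E k)" (is "card ?M = _")
proof -
  let ?P = "proper_colorings {1..l} E k"
  let ?U = "{1..l} \<rightarrow>\<^sub>E (UNIV - {0::'a})"
  define mat where "mat = (\<lambda>(f, c). \<lambda>j\<in>{1..k}. \<lambda>i.
    if i \<in> {1..l} \<and> j = f i then c i else (0::'a))"
  have P: "f i \<in> {1..k}" if "f \<in> ?P" "i \<in> {1..l}" for f i
    using that by (auto simp: proper_colorings_def)
  have U: "c i \<noteq> 0" if "c \<in> ?U" "i \<in> {1..l}" for c i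
    using that by auto
  have entry: "mat (f, c) j i = (if i \<in> {1..l} \<and> j = f i then c i else 0)"
    if "j \<in> {1..k}" for f c i j
    using that by (simp add: mat_def)
  have "bij_betw mat (?P \<times> ?U) ?M"
  proof (rule bij_betw_imageI)
    show "inj_on mat (?P \<times> ?U)"
    proof (rule inj_onI, clarify)
      fix f c g d assume *: "f \<in> ?P" "c \<in> ?U" "g \<in> ?P" "d \<in> ?U" and eq: "mat (f, c) = mat (g, d)"
      have "f i = g i \<and> c i = d i" if i: "i \<in> {1..l}" for i
        using fun_cong[OF fun_cong[OF eq, of "f i"], of i] i U[OF *(2) i] P[OF *(1) i]
        by (auto simp: entry split: if_splits)
      then show "f = g \<and> c = d"
        using * by (auto simp: proper_colorings_def intro!: PiE_ext[of _ "{1..l}"])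
    qed
    show "mat ` (?P \<times> ?U) = ?M"
    proof (intro equalityI subsetI)
      fix y assume "y \<in> mat ` (?P \<times> ?U)"
      then obtain f c where fc: "f \<in> ?P" "c \<in> ?U" "y = mat (f, c)" by auto
      have "\<exists>j\<in>{1..k}. (\<Sum>i\<in>C. a i * y j i) \<noteq> 0"
        if C: "clique {1..l} E C" and a: "\<exists>i\<in>C. a i \<noteq> 0" for C a
      proof -
        obtain m where m: "m \<in> C" "a m \<noteq> 0" using a by blast
        have ml: "m \<in> {1..l}" using m C by (auto simp: clique_def)
        have "a i * y (f m) i = (if i = m then a m * c m else 0)" if "i \<in> C" for i
        proof -
          have "f i \<noteq> f m" if "i \<noteq> m"
            using C m(1) \<open>i \<in> C\<close> that fc(1) unfolding clique_def proper_colorings_def by blast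
          moreover have "i \<in> {1..l}" using \<open>i \<in> C\<close> C by (auto simp: clique_def)
          ultimately show ?thesis
            using P[OF fc(1) ml] by (auto simp: fc(3) entry)
        qed
        then have "(\<Sum>i\<in>C. a i * y (f m) i) = a m * c m"
          using m clique_finite[OF C] by simp
        then show ?thesis using m U[OF fc(2) ml] P[OF fc(1) ml] by (intro bexI[of _ "f m"]) auto
      qed
      moreover have "y \<in> {1..k} \<rightarrow>\<^sub>E coord_space l"
        by (auto simp: fc(3) mat_def coord_space_def)
      ultimately have "y \<in> clique_independent l E k"
        unfolding clique_independent_def by blast
      moreover have "monomial_rows k y"
        unfolding monomial_rows_def fc(3) by (auto simp: entry split: if_splits)
      ultimately show "y \<in> ?M" by blast
    next
      fix y assume "y \<in> ?M"
      then have y: "y \<in> clique_independent l E k" and mono: "monomial_rows k y" by auto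
      have zero: "y j i = 0" if "j \<in> {1..k}" "i \<notin> {1..l}" for j i
        using that y by (auto simp: clique_independent_def coord_space_def PiE_iff)
      have "\<exists>f. \<forall>i\<in>{1..l}. f i \<in> {1..k} \<and> y (f i) i \<noteq> 0"
        by (intro bchoice) (blast elim: clique_independent_row_nonzero[OF y])
      then obtain f' where f': "\<And>i. i \<in> {1..l} \<Longrightarrow> f' i \<in> {1..k} \<and> y (f' i) i \<noteq> 0" by blast
      define f where "f = restrict f' {1..l}"
      define c where "c = (\<lambda>i\<in>{1..l}. y (f i) i)"
      have f: "f i \<in> {1..k}" "y (f i) i \<noteq> 0" if "i \<in> {1..l}" for i
        using f'[OF that] that by (auto simp: f_def)
      have unique: "j = f i" if "j \<in> {1..k}" "i \<in> {1..l}" "y j i \<noteq> 0" for i j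
        using mono that f[OF that(2)] unfolding monomial_rows_def by blast
      have "f u \<noteq> f v" if "{u, v} \<in> E" for u v
      proof
        assume eq: "f u = f v"
        have uv: "u \<in> {1..l}" "v \<in> {1..l}" "u \<noteq> v"
          using assms that by (auto simp: simple_graph_def)
        \<comment> \<open>the relation between the two proportional rows\<close>
        define a where "a = (\<lambda>i. if i = u then c v else - c u)"
        have "clique {1..l} E {u, v}"
          using uv that by (auto simp: clique_def insert_commute)
        moreover have "\<exists>i\<in>{u, v}. a i \<noteq> 0"
          using f[OF uv(2)] uv by (auto simp: a_def c_def)
        ultimately obtain j where j: "j \<in> {1..k}" "(\<Sum>i\<in>{u, v}. a i * y j i) \<noteq> 0"
          using y unfolding clique_independent_def by blast
        then have "c v * y j u - c u * y j v \<noteq> 0"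
          using uv(3) by (simp add: a_def)
        moreover have "c v * y j u = c u * y j v"
        proof (cases "j = f u")
          case True
          then show ?thesis using uv eq by (simp add: c_def mult.commute)
        next
          case False
          then have "y j u = 0" "y j v = 0" using unique[OF j(1)] uv eq by metis+
          then show ?thesis by simp
        qed
        ultimately show False by simp
      qed
      then have "f \<in> ?P"
        using f(1) by (auto simp: proper_colorings_def f_def)
      moreover have "c \<in> ?U" using f(2) by (auto simp: c_def)
      moreover have "y = mat (f, c)"
      proof (intro ext)
        fix j i
        have "y j = undefined" if "j \<notin> {1..k}"
          using that y by (auto simp: clique_independent_def PiE_iff extensional_def)
        moreover have "y j i = 0" if "j \<in> {1..k}" "i \<in> {1..l}" "j \<noteq> f i"
          using unique[of j i] that by blast
        ultimately show "y j i = mat (f, c) j i"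
          using zero[of j i]
          by (cases "j \<in> {1..k}"; cases "i \<in> {1..l}"; cases "j = f i") (simp_all add: mat_def c_def)
      qed
      ultimately show "y \<in> mat ` (?P \<times> ?U)" by blast
    qed
  qed
  then have "card ?M = card (?P \<times> ?U)" by (simp add: bij_betw_same_card)
  then show ?thesis
    by (simp add: card_cartesian_product card_PiE card_Diff_singleton mult.commute)
qed

theorem theorem2p5:
  fixes l k q :: nat
    and E :: "nat set set"
    and A :: "(nat \<Rightarrow> 'a::{field, finite}) set set"
  assumes "simple_graph {1..l} E"
    and "CARD('a) = q"
    and "A = deformed_arrangement l E"
  shows "int (q - 1) ^ l dvd poly (coord.characteristic_poly (coord_space l) A) (int (q ^ k))
    \<and> [poly (coord.characteristic_poly (coord_space l) A) (int (q ^ k)) div int (q - 1) ^ l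
            = poly (chromatic_poly {1..l} E) (int k)] (mod int (q - 1))"
proof -
  let ?S = "clique_independent l E k :: (nat \<Rightarrow> nat \<Rightarrow> 'a) set"
  let ?\<chi> = "poly (coord.characteristic_poly (coord_space l) A) (int (q ^ k))"
  let ?P = "proper_colorings {1..l} E k"
  have "card {0, 1 :: 'a} \<le> q"
    using assms(2) card_mono[of "UNIV :: 'a set" "{0, 1}"] by simp
  then have q: "int (q - 1) \<noteq> 0" by simp
  obtain b where b: "card {y \<in> ?S. \<not> monomial_rows k y} = (q - 1) ^ Suc l * b"
    using card_nonmonomial_dvd[of l E k, where 'a = 'a] assms(2) by (auto elim: dvdE)
  have "card ?S = card {y \<in> ?S. monomial_rows k y} + card {y \<in> ?S. \<not> monomial_rows k y}"
    using finite_clique_independent[of l E k, where 'a = 'a]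
    by (subst card_Un_disjoint[symmetric]) (auto intro: arg_cong[of _ _ card])
  also have "\<dots> = (q - 1) ^ l * (card ?P + (q - 1) * b)"
    using card_monomial[OF assms(1), of k, where 'a = 'a] assms(2) b by (simp add: algebra_simps)
  finally have "?\<chi> = int ((q - 1) ^ l * (card ?P + (q - 1) * b))"
    using poly_characteristic_poly_deformed_arrangement[of l E k, where 'a = 'a] assms(2,3)
    by simp
  then have \<chi>: "?\<chi> = int (q - 1) ^ l * (int (card ?P) + int (q - 1) * int b)"
    by (simp only: of_nat_mult of_nat_power of_nat_add)
  have "?\<chi> div int (q - 1) ^ l = int (card ?P) + int (q - 1) * int b"
    unfolding \<chi> using q by (intro nonzero_mult_div_cancel_left power_not_zero)
  then have "[?\<chi> div int (q - 1) ^ l = int (card ?P)] (mod int (q - 1))"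
    by (simp add: cong_def)
  then show ?thesis
    unfolding poly_chromatic_poly[OF assms(1)] using \<chi> by simp
qed

end
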